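(* Let $\Delta$ be a finite simplicial complex and let $F$ be a facet of $\Delta$ of size $d+1>1$. Write $F^c=V(\Delta)\setminus F$. Suppose that: (1) for any $a,b\in F^c$ there is a sequence $a_1,\dots,a_k\in F^c$ with $a_1=a$, $a_k=b$ and $\{a_i,a_{i+1}\}\in\Delta$ for each $1\le i\le k-1$; (2) for each $c\in F$ and any $a,b\in F^c$ with $\{a,c\},\{b,c\}\in\Delta$, there is a sequence $a_1,\dots,a_k\in F^c$ with $a_1=a$, $a_k=b$ and $\{a_i,a_{i+1},c\}\in\Delta$ for each $1\le i\le k-1$; (3) for each $c\in F$ there is some $w\in F^c$ such that $(F\setminus\{c\})\cup\{w\}\in\Delta$. Then there is a strongly connected simplicial map from $\Delta$ to the simplicial sphere $S_d=\{S\subseteq\{1,\dots,d+2\}:|S|\le d+1\}$.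
   Context: A simplicial complex $\Delta$ on a finite vertex set $V(\Delta)$ is a family of subsets of $V(\Delta)$ (called faces) that is closed under taking subsets and contains all singletons; its edges are its two-element faces, and a facet is an inclusion-maximal face. A simplicial map $\phi:\Delta\to\Gamma$ is a map $V(\Delta)\to V(\Gamma)$ taking faces to faces; it is surjective if every face of $\Gamma$ is the image $\phi(T)$ of some face $T\in\Delta$. A surjective simplicial map $\phi:\Delta\to\Gamma$ is strongly connected if: (i) whenever $a,b\in V(\Delta)$ and $\phi(a)=\phi(b)=c\in V(\Gamma)$, there is a sequence $a=x_1,x_2,\dots,x_k=b$ in $V(\Delta)$ with $\phi(x_i)=c$ for all $i$ and $\{x_i,x_{i+1}\}\in\Delta$ for each $1\le i\le k-1$; (ii) whenever $a,b$ are edges of $\Delta$ and $\phi(a)=\phi(b)=c$ is an edge of $\Gamma$, there is a sequence of edges $a=e_1,e_2,\dots,e_k=b$ of $\Delta$ with $\phi(e_i)=c$ for all $i$, and $e_i\cup e_{i+1}\in\Delta$ and $e_i\cap e_{i+1}\ne\varnothing$ for each $1\le i\le k-1$. *)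

theory Defs
  imports Main
begin

text \<open>A complex is given by its vertex set \<open>V\<close> together with its family of faces \<open>K\<close>.\<close>

definition simplicial_complex :: "'a set \<Rightarrow> 'a set set \<Rightarrow> bool" where
  "simplicial_complex V K \<longleftrightarrow>
     finite V \<and> K \<subseteq> Pow V \<and>
     (\<forall>T\<in>K. \<forall>S. S \<subseteq> T \<longrightarrow> S \<in> K) \<and>
     (\<forall>v\<in>V. {v} \<in> K)"

definition edges :: "'a set set \<Rightarrow> 'a set set" where
  "edges K = {e \<in> K. card e = 2}"

definition facet :: "'a set set \<Rightarrow> 'a set \<Rightarrow> bool" where
  "facet K F \<longleftrightarrow> F \<in> K \<and> (\<forall>T\<in>K. F \<subseteq> T \<longrightarrow> T = F)"

definition simplicial_map ::
  "'a set \<Rightarrow> 'a set set \<Rightarrow> 'b set \<Rightarrow> 'b set set \<Rightarrow> ('a \<Rightarrow> 'b) \<Rightarrow> bool" where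
  "simplicial_map V K W L \<phi> \<longleftrightarrow> \<phi> ` V \<subseteq> W \<and> (\<forall>T\<in>K. \<phi> ` T \<in> L)"

definition surjective_simplicial_map ::
  "'a set \<Rightarrow> 'a set set \<Rightarrow> 'b set \<Rightarrow> 'b set set \<Rightarrow> ('a \<Rightarrow> 'b) \<Rightarrow> bool" where
  "surjective_simplicial_map V K W L \<phi> \<longleftrightarrow>
     simplicial_map V K W L \<phi> \<and> (\<forall>S\<in>L. \<exists>T\<in>K. \<phi> ` T = S)"

text \<open>A sequence \<open>a = x\<^sub>1, \<dots>, x\<^sub>k = b\<close> (\<open>k \<ge> 1\<close>) of elements of \<open>A\<close> whose consecutive members
  are related by \<open>R\<close>. For \<open>k = 1\<close> the condition on consecutive members is void.\<close>

definition joined_in :: "'b set \<Rightarrow> ('b \<Rightarrow> 'b \<Rightarrow> bool) \<Rightarrow> 'b \<Rightarrow> 'b \<Rightarrow> bool" where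
  "joined_in A R a b \<longleftrightarrow>
     (\<exists>xs. xs \<noteq> [] \<and> hd xs = a \<and> last xs = b \<and> set xs \<subseteq> A \<and> successively R xs)"

definition strongly_connected_map ::
  "'a set \<Rightarrow> 'a set set \<Rightarrow> 'b set \<Rightarrow> 'b set set \<Rightarrow> ('a \<Rightarrow> 'b) \<Rightarrow> bool" where
  "strongly_connected_map V K W L \<phi> \<longleftrightarrow>
     surjective_simplicial_map V K W L \<phi> \<and>
     (\<forall>c\<in>W. \<forall>a\<in>V. \<forall>b\<in>V. \<phi> a = c \<and> \<phi> b = c \<longrightarrow>
        joined_in {x \<in> V. \<phi> x = c} (\<lambda>x y. {x, y} \<in> K) a b) \<and>
     (\<forall>c\<in>edges L. \<forall>a\<in>edges K. \<forall>b\<in>edges K. \<phi> ` a = c \<and> \<phi> ` b = c \<longrightarrow>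
        joined_in {e \<in> edges K. \<phi> ` e = c} (\<lambda>e f. e \<union> f \<in> K \<and> e \<inter> f \<noteq> {}) a b)"

definition simplicial_sphere :: "nat \<Rightarrow> nat set set" where
  "simplicial_sphere d = {S. S \<subseteq> {1..d + 2} \<and> card S \<le> d + 1}"

lemma simplicial_complex_sphere: "simplicial_complex {1..d + 2} (simplicial_sphere d)"
proof -
  have "S \<subseteq> {1..d + 2} \<and> card S \<le> d + 1"
    if "T \<subseteq> {1..d + 2}" "card T \<le> d + 1" "S \<subseteq> T" for S T :: "nat set"
    using that card_mono[of T S] finite_subset[of T "{1..d + 2}"] by (auto intro: le_trans)
  then show ?thesis
    unfolding simplicial_complex_def simplicial_sphere_def by auto
qed

end

theory Submission
  imports Defs
begin

(* Send F bijectively onto {1..d+1} and collapse everything outside F to the vertex d+2. The image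
   never contains all d+2 vertices because F is a facet; (3) supplies the faces through d+2.
   The fibre over a vertex or an edge of the sphere avoiding d+2 is a single vertex or edge;
   the remaining fibres are connected by (1) and (2). *)

lemma joined_in_refl: "a \<in> A \<Longrightarrow> joined_in A R a a"
  unfolding joined_in_def by (rule exI[of _ "[a]"]) simp

text \<open>Turns a sequence of vertices into a sequence of edges: it will be used with
  \<open>f\<close> sending \<open>x\<close> to \<open>{x, p}\<close>. Membership in \<open>B\<close>
  is demanded only at the start and otherwise propagated by \<open>step\<close>, because
  \<open>{y, p}\<close> is known to be a face only through the link that leads to
  \<open>y\<close>.\<close>

lemma joined_in_map:
  assumes "joined_in A R a b" and "f a \<in> B"
    and step: "\<And>x y. x \<in> A \<Longrightarrow> y \<in> A \<Longrightarrow> R x y \<Longrightarrow> f y \<in> B \<and> S (f x) (f y)"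
  shows "joined_in B S (f a) (f b)"
proof -
  obtain xs where "xs \<noteq> []" "hd xs = a" "last xs = b" "set xs \<subseteq> A" "successively R xs"
    using assms(1) unfolding joined_in_def by blast
  \<comment> \<open>The premise on \<open>f (hd xs)\<close> is the invariant of the induction:
    \<open>step\<close> hands it on from each entry to the next.\<close>
  moreover have "set (map f xs) \<subseteq> B \<and> successively S (map f xs)"
    if "set xs \<subseteq> A" "successively R xs" "xs \<noteq> []" "f (hd xs) \<in> B"
    using that
  proof (induction xs)
    case (Cons x xs)
    then show ?case
      using step by (cases xs) auto
  qed simp
  ultimately show ?thesis
    using assms(2) unfolding joined_in_def
    by (intro exI[of _ "map f xs"]) (auto simp: hd_map last_map)
qed

theorem theorem3p13:
  fixes V :: "'a set" and \<Delta> :: "'a set set" and F :: "'a set" and d :: nat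
  assumes "simplicial_complex V \<Delta>"
    and "facet \<Delta> F"
    and "card F = d + 1"
    and "d + 1 > 1"
    and "\<And>a b. a \<in> V - F \<Longrightarrow> b \<in> V - F \<Longrightarrow>
           joined_in (V - F) (\<lambda>x y. {x, y} \<in> \<Delta>) a b"
    and "\<And>c a b. c \<in> F \<Longrightarrow> a \<in> V - F \<Longrightarrow> b \<in> V - F \<Longrightarrow> {a, c} \<in> \<Delta> \<Longrightarrow> {b, c} \<in> \<Delta> \<Longrightarrow>
           joined_in (V - F) (\<lambda>x y. {x, y, c} \<in> \<Delta>) a b"
    and "\<And>c. c \<in> F \<Longrightarrow> \<exists>w\<in>V - F. (F - {c}) \<union> {w} \<in> \<Delta>"
  shows "\<exists>\<phi> :: 'a \<Rightarrow> nat. strongly_connected_map V \<Delta> {1..d + 2} (simplicial_sphere d) \<phi>"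
proof -
  have finV: "finite V" and KV: "T \<subseteq> V" and down: "S \<subseteq> T \<Longrightarrow> S \<in> \<Delta>"
    if "T \<in> \<Delta>" for S T
    using assms(1) that unfolding simplicial_complex_def by blast+
  have F\<Delta>: "F \<in> \<Delta>" and Fmax: "\<And>T. T \<in> \<Delta> \<Longrightarrow> F \<subseteq> T \<Longrightarrow> T = F"
    using assms(2) unfolding facet_def by blast+
  have FV: "F \<subseteq> V" using KV F\<Delta> by blast
  have "finite F" using finV[OF F\<Delta>] FV finite_subset by blast
  then obtain g where g: "bij_betw g F {1..d + 1}"
    using assms(3) finite_same_card_bij[of F "{1..d + 1}"] by auto
  define \<phi> where "\<phi> x = (if x \<in> F then g x else d + 2)" for x
  have "g x \<noteq> d + 2" if "x \<in> F" for x
    using bij_betwE[OF g] that by fastforce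
  then have \<phi>_out: "\<phi> x = d + 2 \<longleftrightarrow> x \<notin> F" for x
    unfolding \<phi>_def by simp
  have inj: "inj_on \<phi> F"
    using g unfolding bij_betw_def inj_on_def \<phi>_def by simp
  have img: "\<phi> ` F = {1..d + 1}"
    using g unfolding bij_betw_def \<phi>_def by simp
  have range: "\<phi> x \<in> {1..d + 2}" for x
  proof (cases "x \<in> F")
    case True
    then have "\<phi> x \<in> {1..d + 1}" using img by blast
    then show ?thesis by simp
  next
    case False
    then show ?thesis unfolding \<phi>_def by simp
  qed

  have "\<phi> ` T \<in> simplicial_sphere d" if T: "T \<in> \<Delta>" for T
  proof -
    have "\<phi> ` T \<noteq> {1..d + 2}"
    proof
      assume full: "\<phi> ` T = {1..d + 2}"
      \<comment> \<open>For \<open>x\<close> in \<open>F\<close> the value \<open>\<phi> x\<close>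
        differs from \<open>d + 2\<close>, so it is attained only within \<open>F\<close>, and there
        only at \<open>x\<close> by injectivity. A full image thus forces
        \<open>F \<subseteq> T\<close>, and maximality then gives \<open>T = F\<close>, whose image
        misses \<open>d + 2\<close>.\<close>
      have "F \<subseteq> T"
      proof
        fix x assume x: "x \<in> F"
        then obtain y where y: "y \<in> T" "\<phi> y = \<phi> x"
          using range[of x] full by (metis imageE)
        then show "x \<in> T" using x inj \<phi>_out unfolding inj_on_def by metis
      qed
      then have "\<phi> ` T = {1..d + 1}" using Fmax T img by blast
      then have "d + 2 \<in> {1..d + 1}" using full by simp
      then show False by simp
    qed
    then have "\<phi> ` T \<subset> {1..d + 2}" using range by blast
    then have "card (\<phi> ` T) < card {1..d + 2}" by (intro psubset_card_mono) simp
    then show ?thesis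
      unfolding simplicial_sphere_def using range by auto
  qed
  then have simp_map: "simplicial_map V \<Delta> {1..d + 2} (simplicial_sphere d) \<phi>"
    unfolding simplicial_map_def using range by blast

  have surj: "\<exists>T\<in>\<Delta>. \<phi> ` T = S" if S: "S \<in> simplicial_sphere d" for S
  proof -
    have S2: "S \<subseteq> {1..d + 2}" and cS: "card S \<le> d + 1"
      using S unfolding simplicial_sphere_def by auto
    \<comment> \<open>The part of \<open>S\<close> away from \<open>d + 2\<close> lifts to some
      \<open>T \<subseteq> F\<close>, a face because \<open>F\<close> is one. Only the vertex
      \<open>d + 2\<close> may still have to be covered.\<close>
    have "S - {d + 2} \<subseteq> \<phi> ` F" 
    proof
      fix x assume "x \<in> S - {d + 2}"
      then have "x \<in> {1..d + 2}" "x \<noteq> d + 2" using S2 by auto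
      then show "x \<in> \<phi> ` F" unfolding img by simp
    qed
    then obtain T where T: "T \<subseteq> F" "\<phi> ` T = S - {d + 2}" by (metis subset_imageE)
    show ?thesis
    proof (cases "d + 2 \<in> S")
      case False
      then show ?thesis using T down[OF F\<Delta>] by auto
    next
      case True
      have "T \<noteq> F"
      proof
        assume "T = F"
        then have "S = insert (d + 2) {1..d + 1}"
          using T(2) img insert_Diff[OF True] by simp
        then show False using cS by simp
      qed
      then obtain c where c: "c \<in> F" "c \<notin> T" using T by blast
      obtain w where w: "w \<in> V - F" "(F - {c}) \<union> {w} \<in> \<Delta>" using assms(7)[OF c(1)] by blast
      have "insert w T \<subseteq> (F - {c}) \<union> {w}" using c(2) T(1) by blast
      then have "insert w T \<in> \<Delta>" using down[OF w(2)] by blast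
      moreover have "\<phi> ` insert w T = S" using T(2) \<phi>_out[of w] w(1) insert_Diff[OF True] by simp
      ultimately show ?thesis by blast
    qed
  qed

  have vert: "joined_in {x \<in> V. \<phi> x = c} (\<lambda>x y. {x, y} \<in> \<Delta>) a b"
    if "a \<in> V" "b \<in> V" "\<phi> a = c" "\<phi> b = c" for a b c
  proof (cases "c = d + 2")
    case True
    then have "{x \<in> V. \<phi> x = c} = V - F" using \<phi>_out by auto
    then show ?thesis using assms(5)[of a b] that by auto
  next
    case False
    then have "a = b" using that \<phi>_out inj unfolding inj_on_def by metis
    then show ?thesis using that by (auto intro: joined_in_refl)
  qed

  have split_edge: "\<exists>u p. e = {u, p} \<and> u \<in> V - F \<and> p \<in> F"
    if e: "e \<in> edges \<Delta>" and top: "d + 2 \<in> \<phi> ` e" and card2: "card (\<phi> ` e) = 2" for e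
  proof -
    obtain x y where xy: "e = {x, y}" "e \<in> \<Delta>"
      using e unfolding edges_def card_2_iff by blast
    then have "\<phi> x \<noteq> \<phi> y" using card2 by auto
    moreover have "\<phi> x = d + 2 \<or> \<phi> y = d + 2" using xy top by auto
    ultimately show ?thesis 
      using xy KV[OF xy(2)] \<phi>_out[of x] \<phi>_out[of y] by auto
  qed

  have edge: "joined_in {e \<in> edges \<Delta>. \<phi> ` e = c} (\<lambda>e f. e \<union> f \<in> \<Delta> \<and> e \<inter> f \<noteq> {}) a b"
    if c: "c \<in> edges (simplicial_sphere d)" and a: "a \<in> edges \<Delta>" and b: "b \<in> edges \<Delta>"
      and ac: "\<phi> ` a = c" and bc: "\<phi> ` b = c" for a b c
  proof (cases "d + 2 \<in> c")
    case False
    then have "a \<subseteq> F" "b \<subseteq> F" using ac bc \<phi>_out by (metis image_eqI subsetI)+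
    then have "a = b" using inj ac bc by (metis inj_on_image_eq_iff)
    then show ?thesis using b bc by (auto intro: joined_in_refl)
  next
    case True
    have c2: "card c = 2" using c unfolding edges_def by blast
    obtain u p where up: "a = {u, p}" "u \<in> V - F" "p \<in> F"
      using split_edge[OF a] True c2 ac by blast
    obtain v q where vq: "b = {v, q}" "v \<in> V - F" "q \<in> F"
      using split_edge[OF b] True c2 bc by blast
    have out: "\<phi> x = d + 2" if "x \<in> V - F" for x using \<phi>_out that by blast
    have cp: "c = {d + 2, \<phi> p}" and cq: "c = {d + 2, \<phi> q}"
      using ac bc up vq out by auto
    \<comment> \<open>Two edges over the same \<open>c\<close> share their endpoint in
      \<open>F\<close>, so they can differ only in the endpoint outside it.\<close>
    then have "\<phi> p = \<phi> q" by (metis doubleton_eq_iff)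
    then have pq: "p = q" using inj up vq unfolding inj_on_def by blast
    have fibre: "{x, p} \<in> {e \<in> edges \<Delta>. \<phi> ` e = c}" if "x \<in> V - F" "{x, p} \<in> \<Delta>" for x
    proof -
      have "x \<noteq> p" using that up by blast
      then show ?thesis using that cp out unfolding edges_def by auto
    qed
    have up\<Delta>: "{u, p} \<in> \<Delta>" and vp\<Delta>: "{v, p} \<in> \<Delta>" using a b up vq pq unfolding edges_def by auto
    \<comment> \<open>Hypothesis (2) at \<open>p\<close> joins \<open>u\<close> to \<open>v\<close>
      outside \<open>F\<close>. Adding \<open>p\<close> to each vertex of that sequence gives edges
      over \<open>c\<close>; neighbours meet in \<open>p\<close>, and their union is the face
      \<open>{x, y, p}\<close>.\<close>
    have "joined_in {e \<in> edges \<Delta>. \<phi> ` e = c} (\<lambda>e f. e \<union> f \<in> \<Delta> \<and> e \<inter> f \<noteq> {}) {u, p} {v, p}"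
    proof (rule joined_in_map[where f = "\<lambda>x. {x, p}"])
      show "joined_in (V - F) (\<lambda>x y. {x, y, p} \<in> \<Delta>) u v"
        using assms(6)[OF up(3,2) vq(2) up\<Delta> vp\<Delta>] .
      show "{u, p} \<in> {e \<in> edges \<Delta>. \<phi> ` e = c}" using fibre up(2) up\<Delta> by blast
      fix x y assume xy: "x \<in> V - F" "y \<in> V - F" "{x, y, p} \<in> \<Delta>"
      have "{y, p} \<in> \<Delta>" using down[OF xy(3)] by blast
      moreover have "{x, p} \<union> {y, p} = {x, y, p}" by blast
      ultimately show "{y, p} \<in> {e \<in> edges \<Delta>. \<phi> ` e = c} \<and>
          {x, p} \<union> {y, p} \<in> \<Delta> \<and> {x, p} \<inter> {y, p} \<noteq> {}"
        using fibre xy by auto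
    qed
    then show ?thesis using up vq pq by simp
  qed

  have "strongly_connected_map V \<Delta> {1..d + 2} (simplicial_sphere d) \<phi>"
    unfolding strongly_connected_map_def surjective_simplicial_map_def
    by (intro conjI ballI impI simp_map; (elim conjE)?) (rule surj vert edge; assumption)+
  then show ?thesis by blast
qed

end
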